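(* Consider a double round-robin tournament with four teams, under the rules given in the context, after Matchday 4 (i.e. each team has played four matches). "Runner-up" and "third-placed team" refer to the teams ranked second and third after Matchday 4. (i) If the tie-breaking rule is goal difference, then a team will certainly be fourth in the final ranking after Matchday 4 if and only if it has at least seven points less than the third-placed team. (ii) If the tie-breaking rule is head-to-head records, then a team will certainly be fourth in the final ranking after Matchday 4 if and only if either it has at least seven points less than the third-placed team, or all of the following conditions hold: - it has six points less than the third-placed team; and - it has at least seven points less than the runner-up; and - it has played two matches against the third-placed team.
   Context: Double round-robin tournament with four teams: each team plays each of the other three teams exactly twice (once at home, once away). The tournament consists of six rounds (Matchdays 1 to 6); in each round two matches are played so that every team plays exactly one match. The two matches of a round are played simultaneously, so after a given round exactly the results of the matches of that round and all previous rounds are known. Schedule assumption: a team can play its second match against another team only after it has played once against all other teams (so Matchdays 1-3 form a single round-robin, and so do Matchdays 4-6). Match results: the result of a match is a pair of non-negative integers (goals scored by the two teams), without an upper bound. A win is worth 3 points, a draw 1 point, a loss 0 points. Ranking: teams are ranked by total number of points. Ties in points are broken either by goal difference (total goals scored minus total goals conceded in all group matches, higher is better), or by head-to-head results/records (higher number of points obtained in the matches played among the tied teams, followed by superior goal difference in the matches played among the tied teams). The final ranking is the one after all six rounds. A team will certainly be fourth in the final ranking after Matchday 4 if it is ranked fourth in the final ranking for all possible results of the matches still to be played (Matchdays 5 and 6). *)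

theory Defs
  imports Main "HOL-Library.Cardinality"
begin

text \<open>A match is a pair (home team, away team); a schedule assigns to each matchday the set of its
  matches.\<close>

type_synonym 't match = "'t \<times> 't"
type_synonym 't schedule = "nat \<Rightarrow> 't match set"

text \<open>The result of a match is the pair (goals of the home team, goals of the away team).  A function
  of this type gives the results of all matches of the tournament; what is known at a given time is
  its restriction to the matches already played.\<close>

type_synonym 't results = "'t match \<Rightarrow> nat \<times> nat"

definition plays :: "'t match \<Rightarrow> 't \<Rightarrow> bool" where
  "plays m t \<longleftrightarrow> t = fst m \<or> t = snd m"

definition between :: "'t match \<Rightarrow> 't \<Rightarrow> 't \<Rightarrow> bool" where
  "between m s t \<longleftrightarrow> m = (s, t) \<or> m = (t, s)"

text \<open>The last conjunct is the schedule assumption: if the match of \<open>s\<close> against \<open>t\<close> in round \<open>r\<close> is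
  a second one, then \<open>s\<close> has met every other team before round \<open>r\<close>.  For four teams it forces
  rounds 1 to 3, and hence also rounds 4 to 6, to be single round-robins.\<close>

definition valid_schedule :: "'t schedule \<Rightarrow> bool" where
  "valid_schedule S \<longleftrightarrow>
     (\<forall>r\<in>{1..6}. card (S r) = 2 \<and> (\<forall>m\<in>S r. fst m \<noteq> snd m) \<and>
                  (\<forall>t. \<exists>!m. m \<in> S r \<and> plays m t)) \<and>
     (\<forall>h a. h \<noteq> a \<longrightarrow> (\<exists>!r. r \<in> {1..6} \<and> (h, a) \<in> S r)) \<and>
     (\<forall>s t. \<forall>r\<in>{1..6}. \<forall>r'\<in>{1..<r}.
        (\<exists>m\<in>S r. between m s t) \<and> (\<exists>m\<in>S r'. between m s t) \<longrightarrow>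
        (\<forall>u. u \<noteq> s \<longrightarrow> (\<exists>r''\<in>{1..<r}. \<exists>m\<in>S r''. between m s u)))"

definition played :: "'t schedule \<Rightarrow> nat \<Rightarrow> 't match set" where
  "played S d = (\<Union>r\<in>{1..d}. S r)"

definition goals_for :: "'t results \<Rightarrow> 't match \<Rightarrow> 't \<Rightarrow> nat" where
  "goals_for res m t = (if t = fst m then fst (res m) else snd (res m))"

definition goals_against :: "'t results \<Rightarrow> 't match \<Rightarrow> 't \<Rightarrow> nat" where
  "goals_against res m t = (if t = fst m then snd (res m) else fst (res m))"

definition match_points :: "'t results \<Rightarrow> 't match \<Rightarrow> 't \<Rightarrow> nat" where
  "match_points res m t =
     (if goals_for res m t > goals_against res m t then 3
      else if goals_for res m t = goals_against res m t then 1 else 0)"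

definition points :: "'t match set \<Rightarrow> 't results \<Rightarrow> 't \<Rightarrow> nat" where
  "points M res t = (\<Sum>m\<in>{m\<in>M. plays m t}. match_points res m t)"

definition goal_diff :: "'t match set \<Rightarrow> 't results \<Rightarrow> 't \<Rightarrow> int" where
  "goal_diff M res t =
     (\<Sum>m\<in>{m\<in>M. plays m t}. int (goals_for res m t) - int (goals_against res m t))"

text \<open>The matches among all teams having the same total number of points as \<open>t\<close>.\<close>

definition tied_matches :: "'t match set \<Rightarrow> 't results \<Rightarrow> 't \<Rightarrow> 't match set" where
  "tied_matches M res t =
     {m\<in>M. points M res (fst m) = points M res t \<and> points M res (snd m) = points M res t}"

datatype tie_rule = Goal_Difference | Head_To_Head

fun wins_tie :: "tie_rule \<Rightarrow> 't match set \<Rightarrow> 't results \<Rightarrow> 't \<Rightarrow> 't \<Rightarrow> bool" where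
  "wins_tie Goal_Difference M res s t \<longleftrightarrow> goal_diff M res s > goal_diff M res t"
| "wins_tie Head_To_Head M res s t \<longleftrightarrow>
     (let H = tied_matches M res t in
        points H res s > points H res t \<or>
        points H res s = points H res t \<and> goal_diff H res s > goal_diff H res t)"

definition ahead :: "tie_rule \<Rightarrow> 't match set \<Rightarrow> 't results \<Rightarrow> 't \<Rightarrow> 't \<Rightarrow> bool" where
  "ahead rule M res s t \<longleftrightarrow>
     points M res s > points M res t \<or>
     points M res s = points M res t \<and> wins_tie rule M res s t"

text \<open>A ranking assigns the places 1, 2, ... to the teams.  Teams that the tie-breaking rule does not
  separate may be placed in either order (drawing of lots), so several rankings can be admissible.\<close>

definition ranking :: "tie_rule \<Rightarrow> 't match set \<Rightarrow> 't results \<Rightarrow> ('t \<Rightarrow> nat) \<Rightarrow> bool" where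
  "ranking rule M res place \<longleftrightarrow>
     bij_betw place UNIV {1..CARD('t)} \<and>
     (\<forall>s t. ahead rule M res s t \<longrightarrow> place s < place t)"

text \<open>Whatever the results of the matches after matchday \<open>d\<close> (and of any drawing of lots).\<close>

definition certainly_fourth ::
    "tie_rule \<Rightarrow> 't schedule \<Rightarrow> 't results \<Rightarrow> nat \<Rightarrow> 't \<Rightarrow> bool" where
  "certainly_fourth rule S res d t \<longleftrightarrow>
     (\<forall>res'. (\<forall>m\<in>played S d. res' m = res m) \<longrightarrow>
        (\<forall>place. ranking rule (played S 6) res' place \<longrightarrow> place t = 4))"

end

theory Submission
  imports Defs "HOL-Library.Product_Lexorder"
begin

text \<open>Rounds 4 to 6 form a single round-robin, so in the last two rounds \<open>t\<close> meets two different
  teams \<open>a\<close> and \<open>b\<close>, while its two matches against the remaining team \<open>c\<close> are over.  The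
  worst case for the claim that \<open>t\<close> stays fourth is that \<open>t\<close> wins both matches with a huge goal
  difference and some team \<open>x\<close> at most six points ahead loses both.  Under goal difference \<open>t\<close> then
  overtakes \<open>x\<close>.  Under head-to-head records this also works if \<open>x\<close> is less than six points ahead,
  or if \<open>x\<close> still has to play \<open>t\<close>: as the other two teams score in the last two rounds, the tie is
  between \<open>t\<close> and \<open>x\<close> alone, and the high win decides it.  The exceptional case is that only \<open>c\<close>
  is six points ahead and the others are further away; there \<open>t\<close> has too few points to have the
  better record against \<open>c\<close>.\<close>

definition remaining :: "'t schedule \<Rightarrow> 't match set" where
  "remaining S = S 5 \<union> S 6"

section \<open>Points and goal differences as sums over matches\<close>

lemma match_points_le: "match_points res m t \<le> 3"
  by (simp add: match_points_def)

text \<open>A decided match distributes 3 + 0 points, a draw 1 + 1. The upper bound caps the total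
  of all points, the lower one forces the opponent of a low-scoring team to have scored.\<close>

lemma match_points_add_bounds:
  assumes "fst m \<noteq> snd m"
  shows "match_points res m (fst m) + match_points res m (snd m) \<le> 3"
    and "2 \<le> match_points res m (fst m) + match_points res m (snd m)"
  using assms by (auto simp: match_points_def goals_for_def goals_against_def)

lemma points_union:
  fixes A B :: "('t::finite) match set"
  assumes "A \<inter> B = {}"
  shows "points (A \<union> B) res t = points A res t + points B res t"
proof -
  have "{m \<in> A \<union> B. plays m t} = {m \<in> A. plays m t} \<union> {m \<in> B. plays m t}" by auto
  then show ?thesis
    unfolding points_def using assms by (simp add: sum.union_disjoint disjoint_iff)
qed

lemma goal_diff_union:
  fixes A B :: "('t::finite) match set"
  assumes "A \<inter> B = {}"
  shows "goal_diff (A \<union> B) res t = goal_diff A res t + goal_diff B res t"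
proof -
  have "{m \<in> A \<union> B. plays m t} = {m \<in> A. plays m t} \<union> {m \<in> B. plays m t}" by auto
  then show ?thesis
    unfolding goal_diff_def using assms by (simp add: sum.union_disjoint disjoint_iff)
qed

lemma points_cong:
  assumes "\<And>m. m \<in> M \<Longrightarrow> res m = res' m"
  shows "points M res t = points M res' t"
  unfolding points_def
  by (rule sum.cong) (auto simp: assms match_points_def goals_for_def goals_against_def)

lemma goal_diff_cong:
  assumes "\<And>m. m \<in> M \<Longrightarrow> res m = res' m"
  shows "goal_diff M res t = goal_diff M res' t"
  unfolding goal_diff_def
  by (rule sum.cong) (auto simp: assms goals_for_def goals_against_def)

lemma points_mono:
  fixes A B :: "('t::finite) match set"
  assumes "A \<subseteq> B"
  shows "points A res t \<le> points B res t"
  unfolding points_def using assms by (intro sum_mono2) auto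

text \<open>A deliberately crude bound by all goals scored in \<open>M\<close>: it tells how high a
  win must be to outweigh every goal difference accumulated so far.\<close>

lemma abs_goal_diff_le:
  fixes M :: "('t::finite) match set"
  shows "\<bar>goal_diff M res t\<bar> \<le> (\<Sum>m\<in>M. int (fst (res m) + snd (res m)))"
proof -
  have "\<bar>goal_diff M res t\<bar> \<le> (\<Sum>m\<in>{m\<in>M. plays m t}. int (fst (res m) + snd (res m)))"
    unfolding goal_diff_def
    by (rule order_trans[OF sum_abs]) (rule sum_mono, auto simp: goals_for_def goals_against_def)
  also have "\<dots> \<le> (\<Sum>m\<in>M. int (fst (res m) + snd (res m)))"
    by (rule sum_mono2) auto
  finally show ?thesis .
qed

lemma points_two_legs:
  assumes "a \<noteq> b" and "t = a \<or> t = b"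
  shows "points {(a, b), (b, a)} res t = match_points res (a, b) t + match_points res (b, a) t"
proof -
  have "{m \<in> {(a, b), (b, a)}. plays m t} = {(a, b), (b, a)}"
    using assms(2) by (auto simp: plays_def)
  with assms(1) show ?thesis by (simp add: points_def)
qed

lemma goal_diff_two_legs:
  assumes "a \<noteq> b" and "t = a \<or> t = b"
  shows "goal_diff {(a, b), (b, a)} res t =
    (int (goals_for res (a, b) t) - int (goals_against res (a, b) t)) +
    (int (goals_for res (b, a) t) - int (goals_against res (b, a) t))"
proof -
  have "{m \<in> {(a, b), (b, a)}. plays m t} = {(a, b), (b, a)}"
    using assms(2) by (auto simp: plays_def)
  with assms(1) show ?thesis by (simp add: goal_diff_def)
qed

text \<open>Double counting: after exchanging the sums over teams and matches, each match
  contributes only through its two teams, hence at most 3.\<close>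

lemma sum_points_le:
  fixes M :: "('t::finite) match set"
  assumes "\<And>m. m \<in> M \<Longrightarrow> fst m \<noteq> snd m"
  shows "(\<Sum>t\<in>UNIV. points M res t) \<le> 3 * card M"
proof -
  have "(\<Sum>t\<in>UNIV. points M res t) =
      (\<Sum>t\<in>UNIV. \<Sum>m\<in>M. if plays m t then match_points res m t else 0)"
    unfolding points_def by (intro sum.cong sum.inter_filter) simp_all
  also have "\<dots> = (\<Sum>m\<in>M. \<Sum>t\<in>UNIV. if plays m t then match_points res m t else 0)"
    by (rule sum.swap)
  also have "\<dots> = (\<Sum>m\<in>M. \<Sum>t\<in>{fst m, snd m}. match_points res m t)"
  proof (rule sum.cong[OF refl])
    fix m :: "'t match"
    have "UNIV \<inter> Collect (plays m) = {fst m, snd m}" by (auto simp: plays_def)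
    then show "(\<Sum>t\<in>UNIV. if plays m t then match_points res m t else 0) =
        (\<Sum>t\<in>{fst m, snd m}. match_points res m t)"
      by (simp only: sum.If_cases[OF finite_class.finite_UNIV] sum.neutral_const add_0_right)
  qed
  also have "\<dots> \<le> (\<Sum>m\<in>M. 3)"
    by (rule sum_mono) (simp add: assms match_points_add_bounds)
  finally show ?thesis by simp
qed

section \<open>Consequences of a ranking being admissible\<close>

lemma ranking_points_mono:
  assumes "ranking rule M res place" and "place s < place u"
  shows "points M res u \<le> points M res s"
  using assms by (metis ahead_def leI less_asym' ranking_def)

text \<open>By bijectivity some team holds the last place. Were it not \<open>t\<close>, it would be
  ahead of \<open>t\<close>, and \<open>t\<close> would need a place beyond the last. So drawing
  lots cannot affect \<open>t\<close>.\<close>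

lemma ranking_last:
  fixes place :: "'t::finite \<Rightarrow> nat"
  assumes "ranking rule M res place" and "\<And>s. s \<noteq> t \<Longrightarrow> ahead rule M res s t"
  shows "place t = CARD('t)"
proof -
  have bij: "bij_betw place UNIV {1..CARD('t)}" using assms(1) by (simp add: ranking_def)
  have "CARD('t) \<in> {1..CARD('t)}" by (simp add: Suc_leI)
  then obtain s where s: "place s = CARD('t)" using bij by (metis bij_betw_def imageE)
  have "place t \<le> CARD('t)" using bij by (auto simp: bij_betw_def)
  moreover have "place s < place t" if "s \<noteq> t"
    using assms that by (simp add: ranking_def)
  ultimately show ?thesis using s by fastforce
qed

section \<open>Valid schedules and the last two rounds\<close>

lemma schedule_round_unique:
  assumes "valid_schedule S" and "h \<noteq> a" and "r \<in> {1..6}" "(h, a) \<in> S r"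
    and "r' \<in> {1..6}" "(h, a) \<in> S r'"
  shows "r = r'"
  using assms unfolding valid_schedule_def by blast

lemma schedule_irrefl:
  assumes "valid_schedule S" and "r \<in> {1..6}" and "m \<in> S r"
  shows "fst m \<noteq> snd m"
  using assms unfolding valid_schedule_def by blast

lemma schedule_match_unique:
  assumes "valid_schedule S" and "r \<in> {1..6}"
  shows "\<exists>!m. m \<in> S r \<and> plays m t"
proof -
  have "\<forall>r\<in>{1..6}. card (S r) = 2 \<and> (\<forall>m\<in>S r. fst m \<noteq> snd m) \<and> (\<forall>t. \<exists>!m. m \<in> S r \<and> plays m t)"
    using assms(1) unfolding valid_schedule_def by (rule conjunct1)
  from bspec[OF this assms(2)] show ?thesis by (elim conjE allE)
qed

lemma played_6:
  "played S 6 = played S 4 \<union> remaining S"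
proof -
  have "{1..6} = {1..4} \<union> {5, 6 :: nat}" by auto
  then show ?thesis by (simp add: played_def remaining_def Un_ac)
qed

lemma mem_played_6_iff:
  assumes "valid_schedule S"
  shows "(h, a) \<in> played S 6 \<longleftrightarrow> h \<noteq> a"
proof
  assume "(h, a) \<in> played S 6"
  with schedule_irrefl[OF assms] show "h \<noteq> a" by (force simp: played_def)
next
  assume "h \<noteq> a"
  with assms show "(h, a) \<in> played S 6"
    unfolding valid_schedule_def played_def by blast
qed

lemma match_irrefl:
  assumes "valid_schedule S" and "m \<in> played S 4 \<or> m \<in> remaining S"
  shows "fst m \<noteq> snd m"
  using mem_played_6_iff[OF assms(1), of "fst m" "snd m"] assms(2) by (auto simp: played_6)

lemma played_4_remaining_disjoint:
  assumes "valid_schedule S"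
  shows "played S 4 \<inter> remaining S = {}"
proof (rule ccontr)
  assume "played S 4 \<inter> remaining S \<noteq> {}"
  then obtain h a r where ha: "(h, a) \<in> S r" "r \<in> {1..4}" "(h, a) \<in> remaining S"
    unfolding played_def by fast
  then obtain r' where r': "(h, a) \<in> S r'" "r' = 5 \<or> r' = 6"
    by (auto simp: remaining_def)
  have "h \<noteq> a" using schedule_irrefl[OF assms _ ha(1)] ha(2) by simp
  from schedule_round_unique[OF assms this _ ha(1) _ r'(1)] ha(2) r'(2) show False by auto
qed

lemma card_played_le:
  assumes "valid_schedule S"
  shows "card (played S 4) \<le> 8"
proof -
  have "card (played S 4) \<le> (\<Sum>r\<in>{1..4}. card (S r))"
    unfolding played_def by (rule card_UN_le) simp
  also have "\<dots> = (\<Sum>r\<in>{1..4::nat}. 2)"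
    using assms unfolding valid_schedule_def by (intro sum.cong refl) force
  finally show ?thesis by simp
qed

text \<open>There is one match in each of rounds 5 and 6, and they differ as ordered pairs since
  each pair (home, away) occurs in one round only. That the opponents differ too rests on the
  schedule assumption and is the subject of \<open>remaining_other_opponent\<close>.\<close>

lemma card_remaining:
  assumes "valid_schedule S"
  shows "card {m \<in> remaining S. plays m t} = 2"
proof -
  obtain m5 where m5: "{m \<in> S 5. plays m t} = {m5}"
    using schedule_match_unique[OF assms, of 5 t] by auto
  obtain m6 where m6: "{m \<in> S 6. plays m t} = {m6}"
    using schedule_match_unique[OF assms, of 6 t] by auto
  have "m5 \<noteq> m6"
  proof
    assume "m5 = m6"
    then have "(fst m5, snd m5) \<in> S 5" "(fst m5, snd m5) \<in> S 6" using m5 m6 by auto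
    with schedule_round_unique[OF assms, of "fst m5" "snd m5" 5 6]
      schedule_irrefl[OF assms, of 5 m5] show False by simp
  qed
  moreover have "{m \<in> remaining S. plays m t} = {m5, m6}"
    using m5 m6 by (auto simp: remaining_def)
  ultimately show ?thesis by simp
qed

lemma points_remaining_le:
  assumes "valid_schedule S"
  shows "points (remaining S) res t \<le> 6"
proof -
  have "points (remaining S) res t \<le> (\<Sum>m\<in>{m \<in> remaining S. plays m t}. 3)"
    unfolding points_def by (rule sum_mono) (rule match_points_le)
  then show ?thesis by (simp add: card_remaining[OF assms])
qed

lemma points_final:
  fixes S :: "('t::finite) schedule"
  assumes "valid_schedule S" and "\<And>m. m \<in> played S 4 \<Longrightarrow> res' m = res m"
  shows "points (played S 6) res' t = points (played S 4) res t + points (remaining S) res' t"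
  unfolding played_6 points_union[OF played_4_remaining_disjoint[OF assms(1)]]
  by (simp add: points_cong[OF assms(2)])

lemma goal_diff_final:
  fixes S :: "('t::finite) schedule"
  assumes "valid_schedule S" and "\<And>m. m \<in> played S 4 \<Longrightarrow> res' m = res m"
  shows "goal_diff (played S 6) res' t =
    goal_diff (played S 4) res t + goal_diff (remaining S) res' t"
  unfolding played_6 goal_diff_union[OF played_4_remaining_disjoint[OF assms(1)]]
  by (simp add: goal_diff_cong[OF assms(2)])

section \<open>Meetings of two given teams\<close>

lemma between_iff: "fst m \<noteq> snd m \<Longrightarrow> u \<noteq> t \<Longrightarrow> between m u t \<longleftrightarrow> plays m u \<and> plays m t"
  by (cases m) (auto simp: between_def plays_def)

text \<open>Pigeonhole: each meeting is one of the two ordered pairs of \<open>u\<close> and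
  \<open>t\<close>, and each pair belongs to a single round.\<close>

lemma no_three_meetings:
  assumes "valid_schedule S" and "u \<noteq> t"
    and "r1 \<in> {1..6}" "m1 \<in> S r1" "between m1 u t"
    and "r2 \<in> {1..6}" "m2 \<in> S r2" "between m2 u t"
    and "r3 \<in> {1..6}" "m3 \<in> S r3" "between m3 u t"
  shows "r1 = r2 \<or> r1 = r3 \<or> r2 = r3"
  using assms schedule_round_unique[OF assms(1), of u t] schedule_round_unique[OF assms(1), of t u]
  unfolding between_def by metis

lemma between_pairs: "between m s t \<longleftrightarrow> m \<in> {(s, t), (t, s)}"
  by (auto simp: between_def)

text \<open>Links the counting condition of the theorem to the continuation of the tournament. Both
  legs occur somewhere in the six rounds, so a leg not yet played is still to come.\<close>

lemma remaining_meeting_iff: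
  fixes S :: "('t::finite) schedule"
  assumes S: "valid_schedule S" and "s \<noteq> t"
  shows "card {m \<in> played S 4. between m s t} = 2 \<longleftrightarrow> {(s, t), (t, s)} \<subseteq> played S 4"
    and "(\<exists>m\<in>remaining S. between m s t) \<longleftrightarrow> \<not> {(s, t), (t, s)} \<subseteq> played S 4"
proof -
  have two: "card {(s, t), (t, s)} = 2" using \<open>s \<noteq> t\<close> by simp
  have eq: "{m \<in> played S 4. between m s t} = played S 4 \<inter> {(s, t), (t, s)}"
    by (auto simp: between_def)
  show "card {m \<in> played S 4. between m s t} = 2 \<longleftrightarrow> {(s, t), (t, s)} \<subseteq> played S 4"
  proof
    assume "card {m \<in> played S 4. between m s t} = 2"
    then have "played S 4 \<inter> {(s, t), (t, s)} = {(s, t), (t, s)}"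
      unfolding eq using two by (intro card_subset_eq) auto
    then show "{(s, t), (t, s)} \<subseteq> played S 4" by blast
  next
    assume "{(s, t), (t, s)} \<subseteq> played S 4"
    then show "card {m \<in> played S 4. between m s t} = 2"
      unfolding eq using two by (simp add: Int_absorb1)
  qed
  have "(s, t) \<in> played S 4 \<union> remaining S" "(t, s) \<in> played S 4 \<union> remaining S"
    using mem_played_6_iff[OF S] \<open>s \<noteq> t\<close> by (auto simp: played_6[symmetric])
  then show "(\<exists>m\<in>remaining S. between m s t) \<longleftrightarrow> \<not> {(s, t), (t, s)} \<subseteq> played S 4"
    using played_4_remaining_disjoint[OF S] unfolding between_pairs by blast
qed

text \<open>With only two teams level, the head-to-head table after six rounds consists of exactly
  their two legs, so it can be evaluated explicitly.\<close>

lemma tied_matches_pair: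
  assumes S: "valid_schedule S" and "s \<noteq> t"
    and "points (played S 6) res s = points (played S 6) res t"
    and "\<And>u. u \<noteq> s \<Longrightarrow> u \<noteq> t \<Longrightarrow> points (played S 6) res u \<noteq> points (played S 6) res t"
  shows "tied_matches (played S 6) res t = {(s, t), (t, s)}"
proof -
  have "points (played S 6) res u = points (played S 6) res t \<longleftrightarrow> u = s \<or> u = t" for u
    using assms(3,4) by blast
  then have "tied_matches (played S 6) res t =
      {m \<in> played S 6. (fst m = s \<or> fst m = t) \<and> (snd m = s \<or> snd m = t)}"
    by (simp only: tied_matches_def)
  also have "\<dots> = {(s, t), (t, s)}"
    by (auto simp: mem_played_6_iff[OF S] \<open>s \<noteq> t\<close> \<open>s \<noteq> t\<close>[symmetric])
  finally show ?thesis .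
qed

section \<open>The continuation in which \<open>t\<close> wins and \<open>x\<close> loses all
  remaining matches\<close>

text \<open>The branch for \<open>t\<close> precedes the one for \<open>x\<close>, so that a match
  between them is a high win of \<open>t\<close>, which is also a defeat of \<open>x\<close>. The
  other matches are drawn to give points to both remaining teams, which keeps these out of a tie.
  \<open>N\<close> stays a parameter, to be chosen above all goals scored so far.\<close>

definition upset :: "'t schedule \<Rightarrow> 't results \<Rightarrow> 't \<Rightarrow> 't \<Rightarrow> nat \<Rightarrow> 't results" where
  "upset S res t x N m =
     (if m \<in> played S 4 then res m
      else if plays m t then (if fst m = t then (N, 0) else (0, N))
      else if plays m x then (if fst m = x then (0, 1) else (1, 0))
      else (0, 0))"

lemma upset_remaining:
  fixes S :: "('t::finite) schedule"
  assumes S: "valid_schedule S" and tx: "t \<noteq> x" and N: "0 < N"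
    and "m \<in> remaining S"
  shows "plays m t \<Longrightarrow> goals_for (upset S res t x N) m t = N \<and>
           goals_against (upset S res t x N) m t = 0"
    and "plays m x \<Longrightarrow> goals_for (upset S res t x N) m x = 0 \<and>
           0 < goals_against (upset S res t x N) m x"
    and "plays m u \<Longrightarrow> u \<noteq> x \<Longrightarrow> \<not> plays m t \<Longrightarrow>
           goals_against (upset S res t x N) m u \<le> goals_for (upset S res t x N) m u"
proof -
  have m: "m \<notin> played S 4" using played_4_remaining_disjoint[OF S] assms(4) by blast
  have "fst m \<noteq> snd m"
    using match_irrefl[OF S] assms(4) by blast
  with m tx N show "plays m t \<Longrightarrow> goals_for (upset S res t x N) m t = N \<and>
           goals_against (upset S res t x N) m t = 0"
    and "plays m x \<Longrightarrow> goals_for (upset S res t x N) m x = 0 \<and>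
           0 < goals_against (upset S res t x N) m x"
    and "plays m u \<Longrightarrow> u \<noteq> x \<Longrightarrow> \<not> plays m t \<Longrightarrow>
           goals_against (upset S res t x N) m u \<le> goals_for (upset S res t x N) m u"
    by (auto simp: upset_def goals_for_def goals_against_def plays_def)
qed

lemma upset_points:
  fixes S :: "('t::finite) schedule"
  assumes S: "valid_schedule S" and tx: "t \<noteq> x" and N: "0 < N"
  shows "points (played S 6) (upset S res t x N) t = points (played S 4) res t + 6"
    and "points (played S 6) (upset S res t x N) x = points (played S 4) res x"
proof -
  note final = points_final[OF S, of "upset S res t x N" res]
  have "points (remaining S) (upset S res t x N) t = (\<Sum>m\<in>{m \<in> remaining S. plays m t}. 3)"
    unfolding points_def
    by (rule sum.cong) (use upset_remaining(1)[OF S tx N] N in \<open>auto simp: match_points_def\<close>)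
  also have "\<dots> = 6" by (simp add: card_remaining[OF S])
  finally show "points (played S 6) (upset S res t x N) t = points (played S 4) res t + 6"
    using final by (simp add: upset_def)
  have "points (remaining S) (upset S res t x N) x = (\<Sum>m\<in>{m \<in> remaining S. plays m x}. 0)"
    unfolding points_def
    by (rule sum.cong) (use upset_remaining(2)[OF S tx N] in \<open>auto simp: match_points_def\<close>)
  then show "points (played S 6) (upset S res t x N) x = points (played S 4) res x"
    using final by (simp add: upset_def)
qed

lemma upset_goal_diff:
  fixes S :: "('t::finite) schedule"
  assumes S: "valid_schedule S" and tx: "t \<noteq> x" and N: "0 < N"
  shows "goal_diff (played S 4) res t + 2 * int N \<le> goal_diff (played S 6) (upset S res t x N) t"
    and "goal_diff (played S 6) (upset S res t x N) x \<le> goal_diff (played S 4) res x"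
proof -
  note final = goal_diff_final[OF S, of "upset S res t x N" res]
  have "goal_diff (remaining S) (upset S res t x N) t =
      (\<Sum>m\<in>{m \<in> remaining S. plays m t}. int N)"
    unfolding goal_diff_def
    by (rule sum.cong) (use upset_remaining(1)[OF S tx N] in auto)
  also have "\<dots> = 2 * int N" by (simp add: card_remaining[OF S])
  finally show "goal_diff (played S 4) res t + 2 * int N
      \<le> goal_diff (played S 6) (upset S res t x N) t"
    using final by (simp add: upset_def)
  have "goal_diff (remaining S) (upset S res t x N) x \<le> 0"
    unfolding goal_diff_def
    by (rule sum_nonpos) (use upset_remaining(2)[OF S tx N] in auto)
  then show "goal_diff (played S 6) (upset S res t x N) x \<le> goal_diff (played S 4) res x"
    using final by (simp add: upset_def)
qed

text \<open>At least one leg is still to be played, and \<open>t\<close> wins it by \<open>N\<close>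
  goals. If the other leg is old, \<open>x\<close> gets at most 3 points from it, so
  \<open>x\<close> can at best draw level on points; then the margin \<open>N\<close> exceeds any
  margin of the old leg.\<close>

lemma upset_head_to_head:
  fixes S :: "('t::finite) schedule"
  assumes S: "valid_schedule S" and tx: "t \<noteq> x" and N: "0 < N"
    and "m \<in> remaining S" "between m t x"
    and big: "(\<Sum>m\<in>played S 4. int (fst (res m) + snd (res m))) < int N"
  shows "points {(t, x), (x, t)} (upset S res t x N) x < points {(t, x), (x, t)} (upset S res t x N) t \<or>
    points {(t, x), (x, t)} (upset S res t x N) x = points {(t, x), (x, t)} (upset S res t x N) t \<and>
    goal_diff {(t, x), (x, t)} (upset S res t x N) x < goal_diff {(t, x), (x, t)} (upset S res t x N) t"
proof -
  define R where "R = upset S res t x N"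
  \<comment> \<open>\<open>N\<close> exceeds the sum of all goals scored so far, hence each single
    score.\<close>
  have small: "fst (R m') < N \<and> snd (R m') < N" if "m' \<in> played S 4" for m'
  proof -
    have "int (fst (res m') + snd (res m')) \<le> (\<Sum>m\<in>played S 4. int (fst (res m) + snd (res m)))"
      by (rule member_le_sum) (use that in auto)
    with big that show ?thesis by (simp add: R_def upset_def)
  qed
  define d where "d m' = int (goals_for R m' t) - int (goals_against R m' t)" for m'
  have legs: "between (t, x) t x" "between (x, t) t x" by (simp_all add: between_def)
  have d_x: "int (goals_for R m' x) - int (goals_against R m' x) = - d m'" if "between m' t x" for m'
    using that tx by (auto simp: d_def between_def goals_for_def goals_against_def)
  have won: "match_points R m' t = 3 \<and> match_points R m' x = 0 \<and> d m' = int N"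
    if "m' \<in> remaining S" "between m' t x" for m'
  proof -
    have "plays m' t" "plays m' x" using that(2) by (auto simp: between_def plays_def)
    with upset_remaining(1,2)[OF S tx N that(1), of res] N show ?thesis
      by (simp add: R_def d_def match_points_def)
  qed
  have old: "match_points R m' x \<le> 3 \<and> - int N < d m'" if "m' \<in> played S 4" for m'
    using small[OF that] by (simp add: match_points_le d_def goals_for_def goals_against_def)
  have cases: "m' \<in> played S 4 \<or> m' \<in> remaining S" if "between m' t x" for m'
    using mem_played_6_iff[OF S, of "fst m'" "snd m'"] that tx by (auto simp: played_6 between_def)
  have tx': "(t, x) \<in> remaining S \<and> (x, t) \<in> remaining S \<or>
     (t, x) \<in> remaining S \<and> (x, t) \<in> played S 4 \<or> (x, t) \<in> remaining S \<and> (t, x) \<in> played S 4"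
    using assms(4,5) cases[of "(t, x)"] cases[of "(x, t)"] by (auto simp: between_def)
  note pts = points_two_legs[OF tx disjI1[OF refl], of R] points_two_legs[OF tx disjI2[OF refl], of R]
  have gds: "goal_diff {(t, x), (x, t)} R t = d (t, x) + d (x, t)"
    "goal_diff {(t, x), (x, t)} R x = - d (t, x) - d (x, t)"
    unfolding goal_diff_two_legs[OF tx disjI1[OF refl]] goal_diff_two_legs[OF tx disjI2[OF refl]]
      d_x[OF legs(1)] d_x[OF legs(2)] by (simp_all add: d_def)
  from tx' show ?thesis
    unfolding R_def[symmetric] pts gds
  proof (elim disjE conjE, goal_cases)
    case 1
    with won[OF _ legs(1)] won[OF _ legs(2)] N show ?case by simp
  next
    case 2
    with won[OF _ legs(1)] old[of "(x, t)"] show ?case by linarith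
  next
    case 3
    with won[OF _ legs(2)] old[of "(t, x)"] show ?case by linarith
  qed
qed

section \<open>Sufficiency of the two criteria\<close>

text \<open>Two matches bring \<open>t\<close> at most six points and nobody loses points, so
  \<open>t\<close> stays strictly behind on points and the tie-breaking rule is never
  consulted.\<close>

lemma certainly_fourth_if_seven:
  fixes S :: "('t::finite) schedule"
  assumes card4: "CARD('t) = 4" and S: "valid_schedule S"
    and "\<And>s. s \<noteq> t \<Longrightarrow> points (played S 4) res t + 7 \<le> points (played S 4) res s"
  shows "certainly_fourth rule S res 4 t"
  unfolding certainly_fourth_def
proof (intro allI impI)
  fix res' place
  assume agree: "\<forall>m\<in>played S 4. res' m = res m"
    and rank: "ranking rule (played S 6) res' place"
  have "ahead rule (played S 6) res' s t" if "s \<noteq> t" for s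
    using assms(3)[OF that] points_final[OF S, of res' res] agree points_remaining_le[OF S, of res' t]
    by (simp add: ahead_def)
  with ranking_last[OF rank] card4 show "place t = 4" by simp
qed

text \<open>Eight matches yield at most 24 points, which leaves at most one point for \<open>t\<close>.  In the two
  matches with \<open>c\<close>, worth at least two points each, \<open>t\<close> therefore got fewer points than \<open>c\<close>.\<close>

lemma certainly_fourth_if_six:
  fixes S :: "('t::finite) schedule"
  assumes card4: "CARD('t) = 4" and S: "valid_schedule S" and "c \<noteq> t"
    and c: "points (played S 4) res t + 6 = points (played S 4) res c"
    and others: "\<And>s. s \<noteq> t \<Longrightarrow> s \<noteq> c \<Longrightarrow>
      points (played S 4) res t + 7 \<le> points (played S 4) res s"
    and legs: "{(c, t), (t, c)} \<subseteq> played S 4"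
  shows "certainly_fourth Head_To_Head S res 4 t"
  unfolding certainly_fourth_def
proof (intro allI impI)
  fix res' place
  assume agree: "\<forall>m\<in>played S 4. res' m = res m"
    and rank: "ranking Head_To_Head (played S 6) res' place"
  note final = points_final[OF S, of res' res]
  have pt: "points (played S 6) res' t \<le> points (played S 4) res t + 6"
    using final agree points_remaining_le[OF S, of res' t] by simp
  have ps: "points (played S 4) res s \<le> points (played S 6) res' s" for s
    using final agree by simp
  have "ahead Head_To_Head (played S 6) res' s t" if "s \<noteq> t" for s
  proof (cases "points (played S 6) res' t < points (played S 6) res' s")
    case True
    then show ?thesis by (simp add: ahead_def)
  next
    case False
    \<comment> \<open>By \<open>others\<close>, every team except \<open>c\<close> ends strictly
      above \<open>t\<close> on points.\<close>
    have "s = c" using others[OF that] False pt ps[of s] by force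
    \<comment> \<open>The final points of \<open>c\<close> are at most those of \<open>t\<close>,
      hence at most the old points of \<open>t\<close> plus 6, which are the old points of
      \<open>c\<close>. So all these numbers coincide.\<close>
    have eq: "points (played S 6) res' c = points (played S 6) res' t"
      using False \<open>s = c\<close> pt ps[of c] c by simp
    have "points (played S 6) res' u \<noteq> points (played S 6) res' t" if "u \<noteq> c" "u \<noteq> t" for u
      using others[OF that(2,1)] pt ps[of u] by simp
    then have tied: "tied_matches (played S 6) res' t = {(c, t), (t, c)}"
      by (intro tied_matches_pair S \<open>c \<noteq> t\<close> eq)
    have "fst m \<noteq> snd m" if "m \<in> played S 4" for m
      using match_irrefl[OF S] that by blast
    then have "(\<Sum>u\<in>UNIV. points (played S 4) res u) \<le> 24"
      using sum_points_le[of "played S 4" res] card_played_le[OF S] by simp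
    moreover have "(\<Sum>u\<in>UNIV. points (played S 4) res u) =
        points (played S 4) res t + points (played S 4) res c +
        (\<Sum>u\<in>UNIV - {t, c}. points (played S 4) res u)"
      using \<open>c \<noteq> t\<close> by (subst sum.subset_diff[of "{t, c}"]) auto
    moreover have "card (UNIV - {t, c}) * (points (played S 4) res t + 7)
        \<le> (\<Sum>u\<in>UNIV - {t, c}. points (played S 4) res u)"
      using sum_bounded_below[of "UNIV - {t, c}" "points (played S 4) res t + 7"
          "points (played S 4) res"] others
      by simp
    moreover have "card (UNIV - {t, c}) = 2"
      using card4 \<open>c \<noteq> t\<close> by (simp add: card_Diff_subset)
    \<comment> \<open>With \<open>p\<close> the points of \<open>t\<close>, the four teams have at
      least \<open>p + (p + 6) + 2 * (p + 7) = 4 * p + 20\<close> points, and at most 24.\<close>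
    ultimately have "points (played S 4) res t \<le> 1" using c by simp
    moreover have "points {(c, t), (t, c)} res' t \<le> points (played S 4) res t"
      using points_mono[OF legs, of res' t] points_cong[of "played S 4" res' res t] agree by simp
    ultimately have le1: "points {(c, t), (t, c)} res' t \<le> 1" by simp
    have "points {(c, t), (t, c)} res' t < points {(c, t), (t, c)} res' c"
      using le1 match_points_add_bounds(2)[of "(c, t)" res'] match_points_add_bounds(2)[of "(t, c)" res']
        \<open>c \<noteq> t\<close> by (simp add: points_two_legs)
    then show ?thesis
      using \<open>s = c\<close> eq tied by (simp add: ahead_def)
  qed
  with ranking_last[OF rank] card4 show "place t = 4" by simp
qed

section \<open>Existence of admissible rankings\<close>

text \<open>Sort the teams by ascending key and number them from the end; equal keys are ordered in
  some arbitrary way, like a drawing of lots.\<close>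

lemma place_by_key:
  fixes key :: "'t::finite \<Rightarrow> 'k::linorder"
  obtains place where "bij_betw place UNIV {1..CARD('t)}"
    and "\<And>s t. key t < key s \<Longrightarrow> place s < place t"
proof -
  let ?n = "CARD('t)"
  obtain ys :: "'t list" where ys: "set ys = UNIV" "distinct ys"
    using finite_distinct_list[OF finite_class.finite_UNIV] by blast
  define xs where "xs = sort_key key ys"
  have xs: "set xs = UNIV" "distinct xs" "sorted (map key xs)"
    using ys by (simp_all add: xs_def)
  have len: "length xs = ?n"
    using distinct_card[OF xs(2)] xs(1) by simp
  have nth: "bij_betw ((!) xs) {..<?n} UNIV"
    using bij_betw_nth[OF xs(2), of "{..<?n}" UNIV] xs(1) len by simp
  define pos where "pos = inv_into {..<?n} ((!) xs)"
  have pos: "bij_betw pos UNIV {..<?n}"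
    unfolding pos_def by (rule bij_betw_inv_into[OF nth])
  have xs_pos: "xs ! pos t = t" for t
    unfolding pos_def using bij_betw_inv_into_right[OF nth] by simp
  have pos_less: "pos t < ?n" for t
    using pos by (auto simp: bij_betw_def)
  \<comment> \<open>Positions run from 0 to \<open>?n - 1\<close> with the best team last, so
    \<open>?n - i\<close> gives it place 1.\<close>
  have "bij_betw (\<lambda>i. ?n - i) {..<?n} {1..?n}"
    by (rule bij_betw_byWitness[where f' = "\<lambda>i. ?n - i"]) auto
  then have "bij_betw ((\<lambda>i. ?n - i) \<circ> pos) UNIV {1..?n}"
    by (rule bij_betw_trans[OF pos])
  moreover have "((\<lambda>i. ?n - i) \<circ> pos) s < ((\<lambda>i. ?n - i) \<circ> pos) t" if "key t < key s" for s t
  proof -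
    have "pos t < pos s"
    proof (rule ccontr)
      assume "\<not> pos t < pos s"
      then have "map key xs ! pos s \<le> map key xs ! pos t"
        by (intro sorted_nth_mono xs(3)) (simp_all add: len pos_less)
      with that show False by (simp add: len pos_less xs_pos)
    qed
    then show ?thesis using pos_less[of s] by simp
  qed
  ultimately show ?thesis by (rule that)
qed

text \<open>Needed because \<open>certainly_fourth\<close> quantifies over all rankings: refuting it
  takes an actual ranking of the constructed results. Both rules are lexicographic comparisons of
  tuples.\<close>

lemma ranking_exists:
  fixes M :: "('t::finite) match set"
  obtains place where "ranking rule M res place"
proof (cases rule)
  case Goal_Difference
  obtain place where "bij_betw place (UNIV :: 't set) {1..CARD('t)}"
    "\<And>s t. (points M res t, goal_diff M res t) < (points M res s, goal_diff M res s)
      \<Longrightarrow> place s < place t"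
    using place_by_key[of "\<lambda>t. (points M res t, goal_diff M res t)"] by blast
  then have "ranking Goal_Difference M res place"
    by (auto simp: ranking_def ahead_def)
  with Goal_Difference show ?thesis using that by simp
next
  case Head_To_Head
  define H where "H = tied_matches M res"
  obtain place where place: "bij_betw place (UNIV :: 't set) {1..CARD('t)}"
    "\<And>s t. (points M res t, points (H t) res t, goal_diff (H t) res t)
        < (points M res s, points (H s) res s, goal_diff (H s) res s)
      \<Longrightarrow> place s < place t"
    using place_by_key[of "\<lambda>t. (points M res t, points (H t) res t, goal_diff (H t) res t)"] by blast
  \<comment> \<open>\<open>H\<close> depends on a team only through its points. Whenever the
    head-to-head components of two keys decide, they therefore come from the same set of
    matches.\<close>
  have H: "H s = H t" if "points M res s = points M res t" for s t
    using that by (simp add: H_def tied_matches_def)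
  have "place s < place t" if "ahead Head_To_Head M res s t" for s t
    by (rule place(2)) (use that H[of s t] in \<open>auto simp: ahead_def Let_def H_def\<close>)
  with place(1) have "ranking Head_To_Head M res place"
    by (simp add: ranking_def)
  with Head_To_Head show ?thesis using that by simp
qed

section \<open>Necessity: letting \<open>t\<close> overtake another team\<close>

text \<open>If \<open>u\<close> met \<open>t\<close> in both remaining rounds, its first four matches would be against only two
  opponents, so one of them is a second meeting that precedes the first meeting with \<open>t\<close>.\<close>

lemma remaining_other_opponent:
  fixes S :: "('t::finite) schedule"
  assumes "CARD('t) = 4" and S: "valid_schedule S" and "u \<noteq> t"
  obtains m where "m \<in> remaining S" "plays m u" "\<not> plays m t"
proof -
  have "\<exists>m\<in>remaining S. plays m u \<and> \<not> plays m t"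
  proof (rule ccontr)
    assume neg: "\<not> ?thesis"
    have last: "\<exists>m\<in>S r. between m u t" if r: "r = 5 \<or> r = 6" for r
    proof -
      obtain m where m: "m \<in> S r" "plays m u"
        using ex1_implies_ex[OF schedule_match_unique[OF S, of r u]] r by auto
      then have "m \<in> remaining S" using that by (auto simp: remaining_def)
      with neg m have "plays m t" by blast
      moreover have "fst m \<noteq> snd m" using schedule_irrefl[OF S _ m(1)] that by auto
      ultimately show ?thesis using between_iff[OF _ \<open>u \<noteq> t\<close>] m by blast
    qed
    obtain m5 m6 where m56: "m5 \<in> S 5" "between m5 u t" "m6 \<in> S 6" "between m6 u t"
      using last[of 5] last[of 6] by blast
    \<comment> \<open>Meetings in rounds 5 and 6 already use up both legs.\<close>
    have early: "\<not> between m u t" if "m \<in> S r" "r \<in> {1..4}" for m r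
    proof
      assume "between m u t"
      with no_three_meetings[OF S \<open>u \<noteq> t\<close> _ that(1) _ _ m56(1,2) _ m56(3,4)] that(2)
      show False by auto
    qed
    have "\<exists>v. v \<noteq> u \<and> (\<exists>m\<in>S r. between m u v)" if r: "r \<in> {1..4}" for r
    proof -
      obtain m where m: "m \<in> S r" "plays m u"
        using ex1_implies_ex[OF schedule_match_unique[OF S, of r u]] r by auto
      have "fst m \<noteq> snd m" using schedule_irrefl[OF S _ m(1)] that by auto
      then have "between m u (if fst m = u then snd m else fst m)"
        "(if fst m = u then snd m else fst m) \<noteq> u"
        using m(2) by (cases m; auto simp: between_def plays_def)+
      with m(1) show ?thesis by blast
    qed
    then obtain opp where opp: "\<And>r. r \<in> {1..4} \<Longrightarrow> opp r \<noteq> u \<and> (\<exists>m\<in>S r. between m u (opp r))"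
      by metis
    have sub: "opp ` {1..4} \<subseteq> UNIV - {u, t}" using opp early by blast
    have "card (UNIV - {u, t}) = 2" using assms(1) \<open>u \<noteq> t\<close> by (simp add: card_Diff_subset)
    then have "\<not> inj_on opp {1..4}" using card_inj_on_le[OF _ sub] by fastforce
    then obtain r r' where r: "r' < r" "r \<in> {1..4}" "r' \<in> {1..4}" "opp r = opp r'"
      unfolding inj_on_def by (metis linorder_neqE_nat)
    then have "\<exists>m\<in>S r. between m u (opp r)" "\<exists>m\<in>S r'. between m u (opp r)"
      using opp[of r] opp[of r'] by auto
    moreover have "r \<in> {1..6}" "r' \<in> {1..<r}" using r by auto
    ultimately have "\<forall>v. v \<noteq> u \<longrightarrow> (\<exists>r''\<in>{1..<r}. \<exists>m\<in>S r''. between m u v)"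
      using S unfolding valid_schedule_def by blast
    then obtain r'' m where "r'' \<in> {1..<r}" "m \<in> S r''" "between m u t"
      using \<open>u \<noteq> t\<close> by metis
    with early[of m r''] r(2) show False by auto
  qed
  then show ?thesis using that by blast
qed

text \<open>In the last two rounds \<open>u\<close> also meets a team other than \<open>t\<close>;
  it beats that team if it is \<open>x\<close> and draws otherwise. The strict gain lifts
  \<open>u\<close> out of a tie at six points above the old score of \<open>t\<close>.\<close>

lemma upset_points_other:
  fixes S :: "('t::finite) schedule"
  assumes S: "valid_schedule S" and tx: "t \<noteq> x" and N: "0 < N"
    and "CARD('t) = 4" and "u \<noteq> t" "u \<noteq> x"
  shows "points (played S 4) res u < points (played S 6) (upset S res t x N) u"
proof -
  obtain m where m: "m \<in> remaining S" "plays m u" "\<not> plays m t"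
    using remaining_other_opponent[OF assms(4) S assms(5)] by blast
  have "0 < match_points (upset S res t x N) m u"
    using upset_remaining(3)[OF S tx N m(1,2) assms(6) m(3), of res] by (auto simp: match_points_def)
  also have "\<dots> \<le> points (remaining S) (upset S res t x N) u"
    unfolding points_def by (rule member_le_sum) (use m in auto)
  finally show ?thesis
    using points_final[OF S, of "upset S res t x N" res u] by (simp add: upset_def)
qed

text \<open>The last hypothesis concerns only a gap of exactly six under head-to-head records: a leg
  against \<open>x\<close> must be left for the high win, and no third team may end level with
  \<open>t\<close> and \<open>x\<close>.\<close>

lemma overtake:
  fixes S :: "('t::finite) schedule"
  assumes card4: "CARD('t) = 4" and S: "valid_schedule S" and "t \<noteq> x"
    and le: "points (played S 4) res x \<le> points (played S 4) res t + 6"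
    and H2H: "rule = Head_To_Head \<Longrightarrow> points (played S 4) res x = points (played S 4) res t + 6 \<Longrightarrow>
      (\<exists>m\<in>remaining S. between m t x) \<and>
      (\<forall>u. u \<noteq> t \<longrightarrow> points (played S 4) res t + 6 \<le> points (played S 4) res u)"
  obtains res' place where "\<forall>m\<in>played S 4. res' m = res m"
    and "ranking rule (played S 6) res' place" and "place t < 4"
proof -
  define G where "G = (\<Sum>m\<in>played S 4. int (fst (res m) + snd (res m)))"
  \<comment> \<open>The goal differences of \<open>t\<close> and \<open>x\<close> so far lie between
    \<open>- G\<close> and \<open>G\<close>. Two wins by \<open>N > G\<close> goals lift
    \<open>t\<close> above \<open>G\<close>, while \<open>x\<close> does not improve.\<close>
  define N where "N = nat (G + 1)"
  have "0 \<le> G" unfolding G_def by (rule sum_nonneg) simp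
  then have N: "0 < N" "G < int N" by (simp_all add: N_def)
  define R where "R = upset S res t x N"
  note pts = upset_points[OF S \<open>t \<noteq> x\<close> N(1), of res, folded R_def]
  have "ahead rule (played S 6) R t x"
  proof (cases "points (played S 4) res x = points (played S 4) res t + 6")
    case False
    with le pts show ?thesis by (simp add: ahead_def)
  next
    case True
    have "wins_tie rule (played S 6) R t x"
    proof (cases rule)
      case Goal_Difference
      then show ?thesis
        using upset_goal_diff[OF S \<open>t \<noteq> x\<close> N(1), of res, folded R_def] N(2)
          abs_goal_diff_le[of "played S 4" res t, folded G_def]
          abs_goal_diff_le[of "played S 4" res x, folded G_def]
        by simp
    next
      case Head_To_Head
      with H2H True obtain m where m: "m \<in> remaining S" "between m t x"
        and ge: "\<And>u. u \<noteq> t \<Longrightarrow> points (played S 4) res t + 6 \<le> points (played S 4) res u"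
        by blast
      have "points (played S 6) R u \<noteq> points (played S 6) R x" if "u \<noteq> t" "u \<noteq> x" for u
        using upset_points_other[OF S \<open>t \<noteq> x\<close> N(1) card4 that, of res, folded R_def]
          ge[OF that(1)] pts True by simp
      then have "tied_matches (played S 6) R x = {(t, x), (x, t)}"
        by (intro tied_matches_pair S \<open>t \<noteq> x\<close>) (simp_all add: pts True)
      with Head_To_Head upset_head_to_head[OF S \<open>t \<noteq> x\<close> N(1) m N(2)[unfolded G_def], folded R_def]
      show ?thesis by auto
    qed
    with True pts show ?thesis by (simp add: ahead_def)
  qed
  moreover obtain place where place: "ranking rule (played S 6) R place"
    using ranking_exists .
  ultimately have "place t < place x" by (simp add: ranking_def)
  also have "place x \<le> 4"
    using place card4 by (auto simp: ranking_def bij_betw_def)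
  finally have "place t < 4" .
  moreover have "\<forall>m\<in>played S 4. R m = res m" by (simp add: R_def upset_def)
  ultimately show ?thesis using that place by blast
qed

lemma not_certainly_fourth:
  fixes S :: "('t::finite) schedule"
  assumes card4: "CARD('t) = 4" and S: "valid_schedule S" and "t \<noteq> x"
    and le: "points (played S 4) res x \<le> points (played S 4) res t + 6"
    and H2H: "rule = Head_To_Head \<Longrightarrow> points (played S 4) res x = points (played S 4) res t + 6 \<Longrightarrow>
      (\<exists>m\<in>remaining S. between m t x) \<and>
      (\<forall>u. u \<noteq> t \<longrightarrow> points (played S 4) res t + 6 \<le> points (played S 4) res u)"
  shows "\<not> certainly_fourth rule S res 4 t"
  using overtake[OF assms] unfolding certainly_fourth_def by (metis less_irrefl)

section \<open>The two equivalences for a given ranking\<close>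

text \<open>Here \<open>b\<close>, \<open>c\<close>, \<open>d\<close> are the teams in places 2, 3,
  4. This extracts from the ranking what the criteria use: point inequalities, together with the
  identification of the runner-up and the third-placed team.\<close>

lemma ranked_teams:
  fixes place :: "'t::finite \<Rightarrow> nat"
  assumes card4: "CARD('t) = 4" and rank: "ranking rule M res place"
  obtains b c d where "d \<noteq> c"
    and "\<forall>s. place s = 2 \<longrightarrow> s = b" and "\<forall>s. place s = 3 \<longrightarrow> s = c"
    and "points M res d \<le> points M res c"
    and "\<forall>s. s \<noteq> d \<longrightarrow> points M res c \<le> points M res s"
    and "\<forall>s. s \<noteq> d \<longrightarrow> s \<noteq> c \<longrightarrow> points M res b \<le> points M res s"
proof -
  have bij: "bij_betw place UNIV {1..4}" using rank card4 by (simp add: ranking_def)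
  define team where "team = inv_into UNIV place"
  have place: "place (team i) = i" if "i \<in> {1..4}" for i
    unfolding team_def using bij_betw_inv_into_right[OF bij that] .
  have team: "team (place s) = s" for s
    unfolding team_def using bij_betw_inv_into_left[OF bij] by simp
  have "{1..4} = {1, 2, 3, 4 :: nat}" by auto
  then have range: "place s \<in> {1, 2, 3, 4}" for s using bij by (auto simp: bij_betw_def)
  show ?thesis
  proof
    show "team 4 \<noteq> team 3" using place[of 3] place[of 4] by auto
    show "\<forall>s. place s = 2 \<longrightarrow> s = team 2" "\<forall>s. place s = 3 \<longrightarrow> s = team 3"
      using team by metis+
    have le: "points M res (team j) \<le> points M res (team i)"
      if "i \<in> {1..4}" "j \<in> {1..4}" "i \<le> j" for i j
      using ranking_points_mono[OF rank, of "team i" "team j"] place that by (cases "i = j") auto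
    then show "points M res (team 4) \<le> points M res (team 3)" by simp
    show "\<forall>s. s \<noteq> team 4 \<longrightarrow> points M res (team 3) \<le> points M res s"
    proof (intro allI impI)
      fix s assume "s \<noteq> team 4"
      then have "place s \<in> {1..4}" "place s \<le> 3" using range[of s] team[of s] by auto
      with le[of "place s" 3] show "points M res (team 3) \<le> points M res s" by (simp add: team)
    qed
    show "\<forall>s. s \<noteq> team 4 \<longrightarrow> s \<noteq> team 3 \<longrightarrow> points M res (team 2) \<le> points M res s"
    proof (intro allI impI)
      fix s assume "s \<noteq> team 4" "s \<noteq> team 3"
      then have "place s \<in> {1..4}" "place s \<le> 2" using range[of s] team[of s] by auto
      with le[of "place s" 2] show "points M res (team 2) \<le> points M res s" by (simp add: team)
    qed
  qed
qed

text \<open>Let \<open>y\<close> be the fourth team. Some remaining match of \<open>t\<close> is not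
  against \<open>y\<close>, and the legs against \<open>c\<close> are over, so it is against
  \<open>x\<close>.\<close>

lemma remaining_opponent:
  fixes S :: "('t::finite) schedule"
  assumes card4: "CARD('t) = 4" and S: "valid_schedule S"
    and "c \<noteq> t" "x \<noteq> t" "x \<noteq> c" and meet: "card {m \<in> played S 4. between m t c} = 2"
  obtains m where "m \<in> remaining S" "between m t x"
proof -
  obtain y where y: "UNIV = {t, c, x, y}"
  proof -
    have "card (UNIV - {t, c, x}) = 1"
      using assms by (simp add: card_Diff_subset)
    then obtain y where "UNIV - {t, c, x} = {y}" using card_1_singletonE by blast
    then show ?thesis using that by blast
  qed
  then have "y \<noteq> t"
  proof -
    have "card {t, c, x} \<le> 3" by (simp add: card_insert_if)
    then show ?thesis using y card4 by (auto simp: insert_commute)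
  qed
  obtain m where m: "m \<in> remaining S" "plays m t" "\<not> plays m y"
    using remaining_other_opponent[OF card4 S \<open>y \<noteq> t\<close>[symmetric]] .
  have irrefl: "fst m \<noteq> snd m"
    using match_irrefl[OF S] m(1) by blast
  have "\<not> between m t c"
    using remaining_meeting_iff[OF S \<open>c \<noteq> t\<close>[symmetric]] meet m(1) by blast
  then have "\<not> plays m c" using between_iff[OF irrefl \<open>c \<noteq> t\<close>[symmetric]] m(2) by simp
  then have "plays m x" using m irrefl y by (cases m) (auto simp: plays_def)
  then have "between m t x" using between_iff[OF irrefl \<open>x \<noteq> t\<close>[symmetric]] m(2) by simp
  then show ?thesis using m(1) that by blast
qed

lemma certainly_fourth_goal_difference_iff:
  fixes S :: "('t::finite) schedule"
  assumes card4: "CARD('t) = 4" and S: "valid_schedule S"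
    and rank: "ranking Goal_Difference (played S 4) res place"
    and third: "place third = 3"
  shows "certainly_fourth Goal_Difference S res 4 t \<longleftrightarrow>
      points (played S 4) res t + 7 \<le> points (played S 4) res third"
proof -
  let ?p = "points (played S 4) res"
  obtain b c d where "d \<noteq> c"
    and b: "\<forall>s. place s = 2 \<longrightarrow> s = b" and c: "\<forall>s. place s = 3 \<longrightarrow> s = c"
    and le: "?p d \<le> ?p c" "\<forall>s. s \<noteq> d \<longrightarrow> ?p c \<le> ?p s"
      "\<forall>s. s \<noteq> d \<longrightarrow> s \<noteq> c \<longrightarrow> ?p b \<le> ?p s"
    by (rule ranked_teams[OF card4 rank]) (rule that)
  have "third = c" using c third by simp
  show ?thesis
  proof
    assume fourth: "certainly_fourth Goal_Difference S res 4 t"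
    show "?p t + 7 \<le> ?p third"
    proof (rule ccontr)
      \<comment> \<open>If \<open>t\<close> is itself third, the last team takes the role of
        \<open>x\<close>; it has no more points than \<open>t\<close>.\<close>
      define x where "x = (if t = c then d else c)"
      assume "\<not> ?thesis"
      then have "t \<noteq> x" "?p x \<le> ?p t + 6"
        using le(1) \<open>d \<noteq> c\<close> \<open>third = c\<close> by (simp_all add: x_def)
      with not_certainly_fourth[OF card4 S] fourth show False by blast
    qed
  next
    assume seven: "?p t + 7 \<le> ?p third"
    \<comment> \<open>Only the last team can have fewer points than the third.\<close>
    with le(2) \<open>third = c\<close> have "t = d" by fastforce
    with seven le(2) \<open>third = c\<close> have "?p t + 7 \<le> ?p s" if "s \<noteq> t" for s
      using that le_trans by blast
    then show "certainly_fourth Goal_Difference S res 4 t"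
      by (rule certainly_fourth_if_seven[OF card4 S])
  qed
qed

text \<open>If the third team is less than six points ahead, points alone suffice. At exactly six,
  \<open>x\<close> is the third team if a leg against it is left. Otherwise the failing condition
  puts the runner-up exactly six points ahead, and \<open>t\<close> still has to meet that
  team.\<close>

lemma head_to_head_overtakable:
  fixes S :: "('t::finite) schedule"
  assumes card4: "CARD('t) = 4" and S: "valid_schedule S"
    and rank: "ranking Head_To_Head (played S 4) res place"
    and second: "place runner_up = 2" and third: "place third = 3"
    and neg: "\<not> (points (played S 4) res t + 7 \<le> points (played S 4) res third \<or>
      (points (played S 4) res t + 6 = points (played S 4) res third \<and>
       points (played S 4) res t + 7 \<le> points (played S 4) res runner_up \<and>
       card {m \<in> played S 4. between m t third} = 2))"
  obtains x where "t \<noteq> x" and "points (played S 4) res x \<le> points (played S 4) res t + 6"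
    and "points (played S 4) res x = points (played S 4) res t + 6 \<longrightarrow>
      (\<exists>m\<in>remaining S. between m t x) \<and>
      (\<forall>u. u \<noteq> t \<longrightarrow> points (played S 4) res t + 6 \<le> points (played S 4) res u)"
proof -
  let ?p = "points (played S 4) res"
  obtain b c d where "d \<noteq> c"
    and b: "\<forall>s. place s = 2 \<longrightarrow> s = b" and c: "\<forall>s. place s = 3 \<longrightarrow> s = c"
    and le: "?p d \<le> ?p c" "\<forall>s. s \<noteq> d \<longrightarrow> ?p c \<le> ?p s"
      "\<forall>s. s \<noteq> d \<longrightarrow> s \<noteq> c \<longrightarrow> ?p b \<le> ?p s"
    by (rule ranked_teams[OF card4 rank]) (rule that)
  have "third = c" "runner_up = b" using b c second third by simp_all
  show ?thesis
  proof (cases "?p c < ?p t + 6")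
    case True
    define x where "x = (if t = c then d else c)"
    have "t \<noteq> x" "?p x < ?p t + 6" using le(1) \<open>d \<noteq> c\<close> True by (simp_all add: x_def)
    then show ?thesis by (intro that[of x]) simp_all
  next
    case False
    with neg \<open>third = c\<close> have eq: "?p c = ?p t + 6" by simp
    with le(2) have "t = d" by fastforce
    with eq le(2) have ge: "?p t + 6 \<le> ?p s" if "s \<noteq> t" for s
      using that by metis
    have "c \<noteq> t" using eq by auto
    show ?thesis
    proof (cases "card {m \<in> played S 4. between m t c} = 2")
      case False
      then have "\<exists>m\<in>remaining S. between m t c"
        using remaining_meeting_iff[OF S \<open>c \<noteq> t\<close>[symmetric]] by simp
      then show ?thesis using \<open>c \<noteq> t\<close> eq ge by (intro that[of c]) simp_all
    next
      case True
      with neg eq \<open>third = c\<close> \<open>runner_up = b\<close> have "?p b \<le> ?p t + 6" by simp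
      moreover have "b \<noteq> c"
        using second third \<open>third = c\<close> \<open>runner_up = b\<close> by auto
      \<comment> \<open>In second place, \<open>t\<close> would have at least as many points as the
        third team \<open>c\<close>, which has six more.\<close>
      moreover have "b \<noteq> t"
      proof
        assume "b = t"
        moreover have "place b = 2" "place c = 3"
          using second third \<open>third = c\<close> \<open>runner_up = b\<close> by simp_all
        ultimately show False using ranking_points_mono[OF rank, of t c] eq by simp
      qed
      moreover obtain m where "m \<in> remaining S" "between m t b"
        using remaining_opponent[OF card4 S \<open>c \<noteq> t\<close> \<open>b \<noteq> t\<close> \<open>b \<noteq> c\<close> True] .
      ultimately show ?thesis using ge[of b] ge by (intro that[of b]) auto
    qed
  qed
qed

lemma certainly_fourth_head_to_head_iff:
  fixes S :: "('t::finite) schedule"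
  assumes card4: "CARD('t) = 4" and S: "valid_schedule S"
    and rank: "ranking Head_To_Head (played S 4) res place"
    and second: "place runner_up = 2" and third: "place third = 3"
  shows "certainly_fourth Head_To_Head S res 4 t \<longleftrightarrow>
      points (played S 4) res t + 7 \<le> points (played S 4) res third \<or>
      (points (played S 4) res t + 6 = points (played S 4) res third \<and>
       points (played S 4) res t + 7 \<le> points (played S 4) res runner_up \<and>
       card {m \<in> played S 4. between m t third} = 2)" (is "?L \<longleftrightarrow> ?R")
proof
  assume ?L
  show ?R
  proof (rule ccontr)
    assume "\<not> ?R"
    then obtain x where "t \<noteq> x" "points (played S 4) res x \<le> points (played S 4) res t + 6"
      and "points (played S 4) res x = points (played S 4) res t + 6 \<longrightarrow>
        (\<exists>m\<in>remaining S. between m t x) \<and>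
        (\<forall>u. u \<noteq> t \<longrightarrow> points (played S 4) res t + 6 \<le> points (played S 4) res u)"
      by (rule head_to_head_overtakable[OF assms]) (rule that)
    with not_certainly_fourth[OF card4 S, of t x res Head_To_Head] \<open>?L\<close> show False by blast
  qed
next
  let ?p = "points (played S 4) res"
  assume ?R
  obtain b c d where "d \<noteq> c"
    and b: "\<forall>s. place s = 2 \<longrightarrow> s = b" and c: "\<forall>s. place s = 3 \<longrightarrow> s = c"
    and le: "?p d \<le> ?p c" "\<forall>s. s \<noteq> d \<longrightarrow> ?p c \<le> ?p s"
      "\<forall>s. s \<noteq> d \<longrightarrow> s \<noteq> c \<longrightarrow> ?p b \<le> ?p s"
    by (rule ranked_teams[OF card4 rank]) (rule that)
  have "third = c" "runner_up = b" using b c second third by simp_all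
  show ?L
  proof (cases "?p t + 7 \<le> ?p third")
    case True
    with le(2) \<open>third = c\<close> have "t = d" by fastforce
    with True le(2) \<open>third = c\<close> have "?p t + 7 \<le> ?p s" if "s \<noteq> t" for s
      using that le_trans by blast
    then show ?thesis by (rule certainly_fourth_if_seven[OF card4 S])
  next
    case False
    with \<open>?R\<close> have six: "?p t + 6 = ?p third" and seven: "?p t + 7 \<le> ?p runner_up"
      and meet: "card {m \<in> played S 4. between m t third} = 2" by simp_all
    have "third \<noteq> t" using six by auto
    with six le(2) \<open>third = c\<close> have "t = d" by fastforce
    \<comment> \<open>The runner-up has the fewest points among the teams other than
      \<open>t\<close> and the third, so its lead of seven extends to the leader.\<close>
    with seven le(3) \<open>third = c\<close> \<open>runner_up = b\<close>
    have others: "?p t + 7 \<le> ?p s" if "s \<noteq> t" "s \<noteq> third" for s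
      using that le_trans by blast
    have "{(third, t), (t, third)} \<subseteq> played S 4"
      using meet remaining_meeting_iff(1)[OF S \<open>third \<noteq> t\<close>[symmetric]] by simp
    then show ?thesis by (intro certainly_fourth_if_six[OF card4 S \<open>third \<noteq> t\<close> six others])
  qed
qed

theorem proposition3p3:
  fixes S :: "('t::finite) schedule" and res :: "'t results" and t :: 't
  assumes "CARD('t) = 4"
    and "valid_schedule S"
  shows "(\<forall>place third.
            ranking Goal_Difference (played S 4) res place \<and> place third = 3 \<longrightarrow>
            (certainly_fourth Goal_Difference S res 4 t \<longleftrightarrow>
               points (played S 4) res t + 7 \<le> points (played S 4) res third)) \<and>
         (\<forall>place runner_up third.
            ranking Head_To_Head (played S 4) res place \<and> place runner_up = 2 \<and> place third = 3 \<longrightarrow>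
            (certainly_fourth Head_To_Head S res 4 t \<longleftrightarrow>
               points (played S 4) res t + 7 \<le> points (played S 4) res third \<or>
               (points (played S 4) res t + 6 = points (played S 4) res third \<and>
                points (played S 4) res t + 7 \<le> points (played S 4) res runner_up \<and>
                card {m \<in> played S 4. between m t third} = 2)))"
  using certainly_fourth_goal_difference_iff[OF assms] certainly_fourth_head_to_head_iff[OF assms]
  by blast

end
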